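(* Let $\mathbf{u}_k\in\mathcal{I}=\{\mathbf{u}\in\mathbb{R}^{n_u}:\mathbf{u}^L\preceq\mathbf{u}\preceq\mathbf{u}^U\}$, $\mathbf{u}^*_{k+1}\in\mathcal{I}$, and $\epsilon_j>0$ for $j=1,\dots,n_g$. Consider the projection problem $$\begin{array}{ll}\underset{\mathbf{u}}{\text{minimize}} & \|\mathbf{u}-\mathbf{u}^*_{k+1}\|_2^2\\ \text{subject to} & \nabla g_{p,j}(\mathbf{u}_k)^T(\mathbf{u}-\mathbf{u}_k)\le-\delta_{g,j}\quad\forall j: g_{p,j}(\mathbf{u}_k)\ge-\epsilon_j,\\ & \mathbf{u}^L\preceq\mathbf{u}\preceq\mathbf{u}^U.\end{array}$$ Let $\mathbf{J}_k\in\mathbb{R}^{n_u\times n_J}$ be the matrix whose columns are the gradients $\nabla g_{p,j}(\mathbf{u}_k)$ of the constraints with $g_{p,j}(\mathbf{u}_k)\ge-\epsilon_j$, together with the gradients of those box constraints that are active at $\mathbf{u}_k$, and let $\mathbf{J}_{k,1},\dots,\mathbf{J}_{k,n_J}$ denote the rows of $\mathbf{J}_k^T$. If no row of $\mathbf{J}_k^T$ is negatively spanned by the other rows, i.e. for every row, which after reordering we call $\mathbf{J}_{k,1}$, $$\nexists\,a_2,\dots,a_{n_J}\ge0:\ \mathbf{J}_{k,1}=-a_2\mathbf{J}_{k,2}-\cdots-a_{n_J}\mathbf{J}_{k,n_J},$$ then there exists a vector $\boldsymbol{\delta}_g=(\delta_{g,j})_j\succ\mathbf{0}$ for which the projection problem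 has a solution.
   Context: Vector inequalities are componentwise. The functions $g_{p,1},\dots,g_{p,n_g}:\mathbb{R}^{n_u}\to\mathbb{R}$ are twice continuously differentiable over $\mathcal{I}$. A box constraint is active at $\mathbf{u}_k$ if $u_{k,i}=u_i^L$ (constraint $u_i^L-u_i\le0$, with gradient $-\mathbf{e}_i$) or $u_{k,i}=u_i^U$ (constraint $u_i-u_i^U\le0$, with gradient $\mathbf{e}_i$), where $\mathbf{e}_i$ is the $i$-th standard basis vector. *)

theory Defs
  imports "HOL-Analysis.Analysis"
begin

definition gradient :: "('a::real_inner \<Rightarrow> real) \<Rightarrow> 'a \<Rightarrow> 'a"
  where "gradient f x = (THE D. GDERIV f x :> D)"

lemma gradient_eqI:
  assumes "GDERIV f x :> D"
  shows "gradient f x = D"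
proof -
  have "D' = D" if "GDERIV f x :> D'" for D'
  proof -
    have "(\<lambda>h. h \<bullet> D') = (\<lambda>h. h \<bullet> D)"
      using that assms unfolding gderiv_def by (rule has_derivative_unique)
    then show ?thesis
      by (metis inner_commute vector_eq_rdot)
  qed
  then show ?thesis
    unfolding gradient_def using assms by (intro the_equality)
qed

(* As S may be closed, the derivatives are taken on an open neighbourhood of S;
   H is the Hessian. *)
definition C2_on :: "(real ^ 'n) set \<Rightarrow> (real ^ 'n \<Rightarrow> real) \<Rightarrow> bool"
  where "C2_on S f \<longleftrightarrow>
    (\<exists>T D. \<exists>H :: real ^ 'n \<Rightarrow> real ^ 'n ^ 'n.
       open T \<and> S \<subseteq> T \<and>
       (\<forall>x\<in>T. GDERIV f x :> D x \<and> (D has_derivative (\<lambda>h. H x *v h)) (at x)) \<and>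
       continuous_on T H)"

(* Constr j is the inequality constraint g j; Lower i and Upper i are the two
   box constraints on coordinate i. *)
datatype 'n constr = Constr nat | Lower 'n | Upper 'n

(* The columns of the matrix J_k, that is, the rows of its transpose, form the
   family J_row g uk indexed by J_index g \<epsilon> ng uL uU uk. A family, unlike a set
   of vectors, keeps constraints with equal gradients apart. *)
definition J_index ::
    "(nat \<Rightarrow> real ^ 'n \<Rightarrow> real) \<Rightarrow> (nat \<Rightarrow> real) \<Rightarrow> nat \<Rightarrow> real ^ 'n \<Rightarrow> real ^ 'n \<Rightarrow> real ^ 'n \<Rightarrow> 'n constr set"
  where "J_index g \<epsilon> ng uL uU uk =
    Constr ` {j \<in> {1..ng}. g j uk \<ge> - \<epsilon> j} \<union>
    Lower ` {i. uk $ i = uL $ i} \<union>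
    Upper ` {i. uk $ i = uU $ i}"

fun J_row :: "(nat \<Rightarrow> real ^ 'n \<Rightarrow> real) \<Rightarrow> real ^ 'n \<Rightarrow> 'n constr \<Rightarrow> real ^ 'n"
  where
    "J_row g uk (Constr j) = gradient (g j) uk"
  | "J_row g uk (Lower i) = - axis i 1"
  | "J_row g uk (Upper i) = axis i 1"

lemma finite_J_index:
  fixes uk :: "real ^ 'n"
  shows "finite (J_index g \<epsilon> ng uL uU uk)"
  by (simp add: J_index_def)

definition neg_spanned_by_others ::
    "('i \<Rightarrow> 'a::real_vector) \<Rightarrow> 'i set \<Rightarrow> 'i \<Rightarrow> bool"
  where "neg_spanned_by_others v A r \<longleftrightarrow>
    (\<exists>a. (\<forall>s\<in>A - {r}. a s \<ge> 0) \<and> v r = - (\<Sum>s\<in>A - {r}. a s *\<^sub>R v s))"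

definition projection_feasible ::
    "(nat \<Rightarrow> real ^ 'n \<Rightarrow> real) \<Rightarrow> (nat \<Rightarrow> real) \<Rightarrow> nat \<Rightarrow> real ^ 'n \<Rightarrow> real ^ 'n \<Rightarrow> real ^ 'n \<Rightarrow>
      (nat \<Rightarrow> real) \<Rightarrow> real ^ 'n \<Rightarrow> bool"
  where "projection_feasible g \<epsilon> ng uL uU uk \<delta> u \<longleftrightarrow>
    (\<forall>j\<in>{1..ng}. g j uk \<ge> - \<epsilon> j \<longrightarrow> gradient (g j) uk \<bullet> (u - uk) \<le> - \<delta> j) \<and>
    uL \<le> u \<and> u \<le> uU"

definition projection_solution ::
    "(nat \<Rightarrow> real ^ 'n \<Rightarrow> real) \<Rightarrow> (nat \<Rightarrow> real) \<Rightarrow> nat \<Rightarrow> real ^ 'n \<Rightarrow> real ^ 'n \<Rightarrow> real ^ 'n \<Rightarrow>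
      real ^ 'n \<Rightarrow> (nat \<Rightarrow> real) \<Rightarrow> real ^ 'n \<Rightarrow> bool"
  where "projection_solution g \<epsilon> ng uL uU uk ustar \<delta> u \<longleftrightarrow>
    is_arg_min (\<lambda>u. (norm (u - ustar))\<^sup>2) (projection_feasible g \<epsilon> ng uL uU uk \<delta>) u"

end

theory Submission
  imports Defs
begin

text \<open>
  By Gordan's theorem, applied to the rows of \<open>J\<close>, the hypothesis yields a direction \<open>d\<close> that has
  a negative inner product with every row. A short step from \<open>uk\<close> along \<open>d\<close> stays inside the box,
  because \<open>d\<close> points strictly inwards at the active box constraints, and it strictly decreases
  every linearised constraint; the amounts of decrease serve as \<open>\<delta>\<close>. The feasible set is then
  nonempty and closed, so the distance to \<open>ustar\<close> attains its minimum.
\<close>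

text \<open>A convex combination equal to 0 has a positive weight, since the weights sum to 1;
  dividing by that weight isolates the corresponding vector.\<close>

lemma zero_in_convex_hull_imp_neg_spanned:
  fixes v :: "'i \<Rightarrow> 'a::real_vector"
  assumes "finite A" "0 \<in> convex hull (v ` A)"
  shows "\<exists>r\<in>A. neg_spanned_by_others v A r"
proof -
  \<comment> \<open>The convex hull only sees the set of vectors, so equal members of the family must be merged.\<close>
  obtain B where B: "B \<subseteq> A" "inj_on v B" "v ` A = v ` B"
    by (metis subset_image_inj order_refl)
  have fB: "finite B" using B(1) assms(1) finite_subset by blast
  from assms(2) B(3) fB obtain c where c: "\<forall>x\<in>v ` B. 0 \<le> c x" "sum c (v ` B) = 1"
    "(\<Sum>x\<in>v ` B. c x *\<^sub>R x) = 0"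
    by (auto simp: convex_hull_finite)
  \<comment> \<open>Weights move from vectors back to indices. The value 0 outside \<open>B\<close>
    lets the sum over \<open>B\<close> be read as a sum over all of \<open>A\<close>.\<close>
  define w where "w = (\<lambda>s. if s \<in> B then c (v s) else 0)"
  have w0: "w s \<ge> 0" for s using c(1) by (auto simp: w_def)
  have "sum w B = 1" using c(2) B(2) by (simp add: sum.reindex w_def)
  then obtain r where r: "r \<in> B" "w r \<noteq> 0"
    by (metis sum.neutral zero_neq_one)
  have wr: "w r > 0" using w0[of r] r(2) by simp
  have "(\<Sum>s\<in>A. w s *\<^sub>R v s) = (\<Sum>s\<in>B. w s *\<^sub>R v s)"
    using assms(1) B(1) by (intro sum.mono_neutral_right) (auto simp: w_def)
  also have "\<dots> = 0" using c(3) B(2) by (simp add: sum.reindex w_def)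
  finally have "w r *\<^sub>R v r + (\<Sum>s\<in>A - {r}. w s *\<^sub>R v s) = 0"
    using r(1) B(1) assms(1) by (subst (asm) sum.remove[of _ r]) auto
  then have "w r *\<^sub>R v r = - (\<Sum>s\<in>A - {r}. w s *\<^sub>R v s)"
    by (simp only: eq_neg_iff_add_eq_0)
  then have "(1 / w r) *\<^sub>R (w r *\<^sub>R v r) = (1 / w r) *\<^sub>R (- (\<Sum>s\<in>A - {r}. w s *\<^sub>R v s))"
    by (rule arg_cong)
  then have "v r = - (\<Sum>s\<in>A - {r}. (w s / w r) *\<^sub>R v s)"
    using wr by (simp add: scaleR_sum_right)
  then show ?thesis
    using r(1) B(1) w0 wr unfolding neg_spanned_by_others_def
    by (intro bexI[of _ r] exI[of _ "\<lambda>s. w s / w r"]) auto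
qed

text \<open>The hull of finitely many vectors is compact and convex; as it misses 0, a hyperplane
  strictly separates it from 0, and the negated normal serves as \<open>d\<close>.\<close>

lemma gordan_direction:
  fixes v :: "'i \<Rightarrow> 'a::euclidean_space"
  assumes "finite A" "\<forall>r\<in>A. \<not> neg_spanned_by_others v A r"
  obtains d where "\<And>r. r \<in> A \<Longrightarrow> v r \<bullet> d < 0"
proof -
  have "0 \<notin> convex hull (v ` A)"
    using zero_in_convex_hull_imp_neg_spanned assms by blast
  moreover have "closed (convex hull (v ` A))"
    using assms(1) by (simp add: compact_imp_closed finite_imp_compact_convex_hull)
  ultimately obtain a b where ab: "0 < b" "\<forall>x\<in>convex hull (v ` A). b < a \<bullet> x"
    using separating_hyperplane_closed_0[OF convex_convex_hull] by metis
  have "v r \<bullet> - a < 0" if "r \<in> A" for r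
    using ab hull_inc[of "v r" "v ` A" convex] that by (force simp: inner_commute)
  then show ?thesis using that by blast
qed

text \<open>Each coordinate bound holds for all small \<open>t > 0\<close>: by the sign of
  \<open>d\<close> where the bound is tight at \<open>uk\<close>, by continuity where it is slack.
  Finitely many coordinates then share one \<open>t\<close>.\<close>

lemma short_step_in_box:
  fixes uL uU uk d :: "real ^ 'n"
  assumes "uk \<in> {uL..uU}"
    and "\<And>i. uk $ i = uL $ i \<Longrightarrow> d $ i > 0"
    and "\<And>i. uk $ i = uU $ i \<Longrightarrow> d $ i < 0"
  obtains t where "t > 0" "uk + t *\<^sub>R d \<in> {uL..uU}"
proof -
  have bounds: "uL $ i \<le> uk $ i" "uk $ i \<le> uU $ i" for i
    using assms(1) by (auto simp: less_eq_vec_def)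
  have lim: "((\<lambda>t. uk $ i + t * d $ i) \<longlongrightarrow> uk $ i) (at_right 0)" for i
    by (auto intro!: tendsto_eq_intros)
  have pos: "\<forall>\<^sub>F t::real in at_right 0. t > 0"
    by (rule eventually_at_right_less)
  have lower: "\<forall>\<^sub>F t in at_right 0. uL $ i \<le> uk $ i + t * d $ i" for i
  proof (cases "uk $ i = uL $ i")
    case True
    show ?thesis using pos by eventually_elim (use assms(2)[OF True] True in auto)
  next
    case False
    then have "uL $ i < uk $ i" using bounds(1)[of i] by simp
    from order_tendstoD(1)[OF lim this] show ?thesis by eventually_elim auto
  qed
  have upper: "\<forall>\<^sub>F t in at_right 0. uk $ i + t * d $ i \<le> uU $ i" for i
  proof (cases "uk $ i = uU $ i")
    case True
    show ?thesis using pos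
      by eventually_elim (use assms(3)[OF True] True in \<open>auto simp: mult_le_0_iff\<close>)
  next
    case False
    then have "uk $ i < uU $ i" using bounds(2)[of i] by simp
    from order_tendstoD(2)[OF lim this] show ?thesis by eventually_elim auto
  qed
  have "\<forall>\<^sub>F t in at_right 0. t > 0 \<and>
      (\<forall>i. uL $ i \<le> uk $ i + t * d $ i \<and> uk $ i + t * d $ i \<le> uU $ i)"
    using pos lower upper by (intro eventually_conj eventually_all_finite) auto
  then obtain t where "t > 0"
      "\<forall>i. uL $ i \<le> uk $ i + t * d $ i \<and> uk $ i + t * d $ i \<le> uU $ i"
    using eventually_happens'[OF trivial_limit_at_right_real] by blast
  then show ?thesis using that by (auto simp: less_eq_vec_def)
qed

lemma closed_projection_feasible:
  "closed {u. projection_feasible g \<epsilon> ng uL uU uk \<delta> u}"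
proof -
  have "{u. projection_feasible g \<epsilon> ng uL uU uk \<delta> u} =
      (\<Inter>j\<in>{j\<in>{1..ng}. g j uk \<ge> - \<epsilon> j}. {u. gradient (g j) uk \<bullet> (u - uk) \<le> - \<delta> j}) \<inter> cbox uL uU"
    by (auto simp: projection_feasible_def interval_cbox_cart[symmetric])
  then show ?thesis
    by (auto intro!: closed_INT closed_Int closed_Collect_le continuous_intros)
qed

text \<open>A nonempty closed set in Euclidean space has a point nearest to \<open>ustar\<close>,
  and squaring preserves the order of distances.\<close>

lemma projection_solution_exists:
  assumes "projection_feasible g \<epsilon> ng uL uU uk \<delta> u0"
  shows "\<exists>u. projection_solution g \<epsilon> ng uL uU uk ustar \<delta> u"
proof -
  let ?F = "{u. projection_feasible g \<epsilon> ng uL uU uk \<delta> u}"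
  obtain u where u: "u \<in> ?F" "\<And>y. y \<in> ?F \<Longrightarrow> dist ustar u \<le> dist ustar y"
    using distance_attains_inf[OF closed_projection_feasible, of g \<epsilon> ng uL uU uk \<delta> ustar] assms
    by blast
  have "(norm (u - ustar))\<^sup>2 \<le> (norm (y - ustar))\<^sup>2"
    if "projection_feasible g \<epsilon> ng uL uU uk \<delta> y" for y
    using u(2)[of y] that by (simp add: dist_norm norm_minus_commute power_mono)
  then show ?thesis
    using u(1) by (auto simp: projection_solution_def is_arg_min_linorder)
qed

theorem theorem4:
  fixes g :: "nat \<Rightarrow> real ^ 'n \<Rightarrow> real"
    and \<epsilon> :: "nat \<Rightarrow> real"
    and ng :: nat
    and uL uU uk ustar :: "real ^ 'n"
  assumes "uk \<in> {uL..uU}"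
    and "ustar \<in> {uL..uU}"
    and "\<And>j. j \<in> {1..ng} \<Longrightarrow> C2_on {uL..uU} (g j)"
    and "\<And>j. j \<in> {1..ng} \<Longrightarrow> \<epsilon> j > 0"
    and "\<forall>r\<in>J_index g \<epsilon> ng uL uU uk.
           \<not> neg_spanned_by_others (J_row g uk) (J_index g \<epsilon> ng uL uU uk) r"
  shows "\<exists>\<delta>. (\<forall>j\<in>{1..ng}. \<delta> j > 0) \<and>
           (\<exists>u. projection_solution g \<epsilon> ng uL uU uk ustar \<delta> u)"
proof -
  let ?A = "J_index g \<epsilon> ng uL uU uk"
  obtain d where d: "\<And>r. r \<in> ?A \<Longrightarrow> J_row g uk r \<bullet> d < 0"
    using gordan_direction[OF finite_J_index assms(5)] by blast
  \<comment> \<open>The row of an active lower bound is \<open>- axis i 1\<close>, so its negative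
    product with \<open>d\<close> makes \<open>d $ i\<close> positive.\<close>
  have "d $ i > 0" if "uk $ i = uL $ i" for i
    using d[of "Lower i"] that by (simp add: J_index_def inner_axis')
  moreover have "d $ i < 0" if "uk $ i = uU $ i" for i
    using d[of "Upper i"] that by (simp add: J_index_def inner_axis')
  ultimately obtain t where t: "t > 0" "uk + t *\<^sub>R d \<in> {uL..uU}"
    using short_step_in_box[OF assms(1)] by blast
  have descent: "gradient (g j) uk \<bullet> d < 0" if "j \<in> {1..ng}" "g j uk \<ge> - \<epsilon> j" for j
    using d[of "Constr j"] that by (simp add: J_index_def)
  \<comment> \<open>With this choice the point \<open>uk + t *\<^sub>R d\<close> meets every
    linearised constraint with equality. The default 1 keeps \<delta> positive at the indices that
    the projection problem leaves unconstrained.\<close>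
  define \<delta> where "\<delta> = (\<lambda>j. if g j uk \<ge> - \<epsilon> j then - t * (gradient (g j) uk \<bullet> d) else 1)"
  have "\<forall>j\<in>{1..ng}. \<delta> j > 0"
    using descent t(1) by (auto simp: \<delta>_def mult_pos_neg)
  moreover have "projection_feasible g \<epsilon> ng uL uU uk \<delta> (uk + t *\<^sub>R d)"
    using t(2) by (simp add: projection_feasible_def \<delta>_def)
  ultimately show ?thesis
    using projection_solution_exists by blast
qed

end
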